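(* Consider self-avoiding walks on the bunkbed graph $K_n\times K_2$ with $n\ge2$, where $K_n$ is the complete graph on $n$ vertices. Then: (1) if $n=2$, then $|\mathscr{S}(u_0,v_0)|=|\mathscr{S}(u_0,v_1)|$ for all distinct $u,v\in V(K_n)$; (2) if $n\in\{3,4,5\}$, then $|\mathscr{S}(u_0,v_0)|<|\mathscr{S}(u_0,v_1)|$ for all distinct $u,v\in V(K_n)$; (3) there exists $N$ such that for all $n\ge N$ and all distinct $u,v\in V(K_n)$, $|\mathscr{S}(u_0,v_0)|<|\mathscr{S}(u_0,v_1)|$.
   Context: For a finite graph $G$, the bunkbed graph $G\times K_2$ is the Cartesian product of $G$ with the complete graph $K_2$ on $\{0,1\}$; the vertex $(u,i)$ is written $u_i$. Its edges are the horizontal edges $u_iv_i$ for $uv\in E(G)$, $i\in\{0,1\}$, and the vertical edges $u_0u_1$ for $u\in V(G)$. A self-avoiding walk from $x$ to $y$ in a graph is a sequence $(w_0,e_1,w_1,\dots,e_m,w_m)$ with $m\ge0$, $w_0=x$, $w_m=y$, all $w_j$ pairwise distinct, and each $e_i$ an edge connecting $w_{i-1}$ and $w_i$. $\mathscr{S}(x,y)$ is the set of self-avoiding walks from $x$ to $y$ (in the bunkbed graph), and $|\cdot|$ denotes cardinality. *)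

theory Defs
  imports Main
begin

record 'a ugraph =
  vertices :: "'a set"
  edges :: "'a set set"

definition finite_ugraph :: "'a ugraph \<Rightarrow> bool" where
  "finite_ugraph G \<longleftrightarrow>
    finite (vertices G) \<and> (\<forall>e\<in>edges G. e \<subseteq> vertices G \<and> card e = 2)"

definition complete_graph :: "nat \<Rightarrow> nat ugraph" where
  "complete_graph n =
    \<lparr>vertices = {..<n}, edges = {{u, v} | u v. u < n \<and> v < n \<and> u \<noteq> v}\<rparr>"

definition bunkbed :: "'a ugraph \<Rightarrow> ('a \<times> nat) ugraph" where
  "bunkbed G =
    \<lparr>vertices = vertices G \<times> {0, 1},
     edges = {{(u, i), (v, i)} | u v i. {u, v} \<in> edges G \<and> i \<in> {0, 1}}
           \<union> {{(u, 0), (u, 1)} | u. u \<in> vertices G}\<rparr>"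

text \<open>A walk \<open>(w\<^sub>0, e\<^sub>1, w\<^sub>1, \<dots>, e\<^sub>m, w\<^sub>m)\<close> is encoded as the pair of its vertex list
  \<open>[w\<^sub>0, \<dots>, w\<^sub>m]\<close> and its edge list \<open>[e\<^sub>1, \<dots>, e\<^sub>m]\<close>.  The length condition makes the vertex
  list nonempty, so \<open>hd\<close> and \<open>last\<close> are meaningful.\<close>

definition saws :: "'a ugraph \<Rightarrow> 'a \<Rightarrow> 'a \<Rightarrow> ('a list \<times> 'a set list) set" where
  "saws G x y =
    {(ws, es).
       length ws = Suc (length es) \<and> hd ws = x \<and> last ws = y \<and>
       distinct ws \<and> set ws \<subseteq> vertices G \<and>
       (\<forall>i<length es. es ! i \<in> edges G \<and> es ! i = {ws ! i, ws ! Suc i})}"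

lemma finite_ugraph_complete_graph: "finite_ugraph (complete_graph n)"
  by (auto simp: finite_ugraph_def complete_graph_def)

lemma finite_ugraph_bunkbed:
  assumes "finite_ugraph G"
  shows "finite_ugraph (bunkbed G)"
proof -
  have "e \<subseteq> vertices (bunkbed G) \<and> card e = 2" if "e \<in> edges (bunkbed G)" for e
  proof -
    from that consider
      (h) u v i where "e = {(u, i), (v, i)}" "{u, v} \<in> edges G" "i \<in> {0, 1}"
      | (v) u where "e = {(u, 0), (u, 1)}" "u \<in> vertices G"
      by (auto simp: bunkbed_def)
    then show ?thesis
    proof cases
      case h
      then have *: "{u, v} \<subseteq> vertices G" "card {u, v} = 2"
        using assms by (auto simp: finite_ugraph_def)
      then have "u \<noteq> v" by auto
      with h * show ?thesis by (auto simp: bunkbed_def)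
    next
      case v
      then show ?thesis by (auto simp: bunkbed_def)
    qed
  qed
  then show ?thesis
    using assms by (auto simp: finite_ugraph_def bunkbed_def)
qed

text \<open>Hence \<open>card\<close> is the true number of self-avoiding walks, not the default value for
  infinite sets.\<close>

lemma finite_saws:
  assumes "finite (vertices G)"
  shows "finite (saws G x y)"
proof -
  let ?V = "vertices G"
  have "saws G x y \<subseteq> {ws. set ws \<subseteq> ?V \<and> length ws \<le> card ?V}
                     \<times> {es. set es \<subseteq> Pow ?V \<and> length es \<le> card ?V}"
  proof (rule subrelI)
    fix ws es assume "(ws, es) \<in> saws G x y"
    then have l: "length ws = Suc (length es)" and d: "distinct ws" and s: "set ws \<subseteq> ?V"
      and e: "\<And>i. i < length es \<Longrightarrow> es ! i = {ws ! i, ws ! Suc i}"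
      by (auto simp: saws_def)
    have "length ws \<le> card ?V"
      using card_mono[OF assms s] d by (simp add: distinct_card)
    moreover have "set es \<subseteq> Pow ?V"
    proof
      fix a assume "a \<in> set es"
      then obtain i where i: "i < length es" "a = es ! i" by (auto simp: in_set_conv_nth)
      then have "ws ! i \<in> set ws" "ws ! Suc i \<in> set ws" using l by auto
      with s i e show "a \<in> Pow ?V" by auto
    qed
    ultimately show "(ws, es) \<in> {ws. set ws \<subseteq> ?V \<and> length ws \<le> card ?V}
                     \<times> {es. set es \<subseteq> Pow ?V \<and> length es \<le> card ?V}"
      using l s by auto
  qed
  moreover have "finite {ws. set ws \<subseteq> ?V \<and> length ws \<le> card ?V}"
    using assms by (rule finite_lists_length_le)
  moreover have "finite {es. set es \<subseteq> Pow ?V \<and> length es \<le> card ?V}"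
    using assms by (intro finite_lists_length_le) simp
  ultimately show ?thesis by (meson finite_SigmaI finite_subset)
qed

end

theory Submission
  imports Defs Complex_Main
begin

text \<open>
  Fix the vertices \<open>c\<^sub>1, \<dots>, c\<^sub>k\<close> at which a walk changes layers. What remains to be chosen
  are the interiors of the horizontal segments, and these choices are independent in the two layers,
  so the walks with given end points are counted by an explicit finite sum over \<open>k\<close>. This settles
  \<open>n \<le> 5\<close> by evaluation. With \<open>m = n - 2\<close> and \<open>H = \<Sum>\<^sub>t m! / t!\<close>, the walks to \<open>v\<^sub>0\<close> with
  \<open>k = 2 j\<close> vertical steps number about \<open>m H\<^sup>2 / (j! (j - 1)!)\<close>, those to \<open>v\<^sub>1\<close> with
  \<open>k = 2 j + 1\<close> about \<open>m H\<^sup>2 / (j!)\<^sup>2\<close>. The first series has sum at most \<open>7/4\<close>, while already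
  the terms \<open>k = 1, 3\<close> of the second one contribute \<open>2\<close>.
\<close>

subsection \<open>Counting formulas\<close>

text \<open>\<open>fill m s\<close> counts the ways to write distinct elements of an \<open>m\<close>-set into \<open>s\<close> ordered
  lists; in the recursion the first list either starts with some element or is empty.\<close>

fun fill :: "nat \<Rightarrow> nat \<Rightarrow> nat" where
  "fill m 0 = 1"
| "fill 0 (Suc s) = 1"
| "fill (Suc m) (Suc s) = Suc m * fill m (Suc s) + fill (Suc m) s"

fun falling :: "nat \<Rightarrow> nat \<Rightarrow> nat" where
  "falling c 0 = 1"
| "falling c (Suc k) = c * falling (c - 1) k"

text \<open>Let \<open>a\<close> and \<open>b\<close> be the numbers of unvisited vertices in the layer of the starting point and
  in the other layer, and \<open>c\<close> the number of vertical edges with both ends unvisited.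
  \<open>walk_term k a b c\<close> counts the walks with exactly \<open>k\<close> vertical steps whose first and last steps are
  horizontal: \<open>falling c k\<close> chooses the vertical steps in order, and then there are \<open>k div 2 + 1\<close>
  segments in the starting layer and \<open>(k + 1) div 2\<close> in the other one. In \<open>walk_count\<close> the flag says
  whether the target lies in the starting layer.\<close>

definition walk_term :: "nat \<Rightarrow> nat \<Rightarrow> nat \<Rightarrow> nat \<Rightarrow> nat" where
  "walk_term k a b c = falling c k * fill (a - k) (k div 2 + 1) * fill (b - k) ((k + 1) div 2)"

definition walk_count :: "bool \<Rightarrow> nat \<Rightarrow> nat \<Rightarrow> nat \<Rightarrow> nat" where
  "walk_count d a b c = (\<Sum>j\<le>c. walk_term (if d then 2 * j else 2 * j + 1) a b c)"

section \<open>Recurrences for the counting formulas\<close>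

lemma fill_zero [simp]: "fill 0 s = 1"
  by (cases s) auto

lemma fill_Suc: "fill m (Suc s) = m * fill (m - 1) (Suc s) + fill m s"
  by (cases m) auto

lemma falling_Suc_right: "falling c (Suc k) = falling c k * (c - k)"
proof (induction k arbitrary: c)
  case (Suc k)
  have "falling c (Suc (Suc k)) = c * (falling (c - 1) k * (c - 1 - k))"
    using Suc.IH[of "c - 1"] by simp
  then show ?case by (simp add: algebra_simps)
qed simp

lemma falling_eq_0: "c < k \<Longrightarrow> falling c k = 0"
proof (induction k arbitrary: c)
  case (Suc k)
  then show ?case by (cases c) auto
qed simp

lemma walk_term_eq_0: "c < k \<Longrightarrow> walk_term k a b c = 0"
  by (simp add: walk_term_def falling_eq_0)

text \<open>Terms with \<open>k > c\<close> vanish, so the range of summation may be enlarged. This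
  allows the sums for \<open>c\<close> and \<open>c - 1\<close> to be compared term by term.\<close>

lemma walk_count_upto:
  assumes "c \<le> N"
  shows "walk_count d a b c = (\<Sum>j\<le>N. walk_term (if d then 2 * j else 2 * j + 1) a b c)"
  unfolding walk_count_def using assms
  by (intro sum.mono_neutral_left) (auto simp: walk_term_eq_0)

text \<open>Double counting of a vertex \<open>x\<close> among \<open>a\<close> together with an
  ordered choice of \<open>k\<close> of the \<open>c\<close> columns avoiding \<open>x\<close>: on
  the left \<open>x\<close> is picked first, on the right last.\<close>

lemma falling_step:
  assumes "c \<le> a"
  shows "(a - c) * falling c k + c * falling (c - 1) k = falling c k * (a - k)"
proof (cases "k \<le> c")
  case True
  have "c * falling (c - 1) k = falling c k * (c - k)"
    using falling_Suc_right[of c k] by simp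
  moreover have "a - k = (a - c) + (c - k)"
    using True assms by simp
  ultimately show ?thesis by (simp add: algebra_simps)
next
  case False
  then show ?thesis by (cases "c = 0") (auto simp: falling_eq_0)
qed

lemma walk_term_0_step:
  assumes "c \<le> a"
  shows "walk_term 0 a b c = 1 + (a - c) * walk_term 0 (a - 1) b c + c * walk_term 0 (a - 1) b (c - 1)"
proof -
  have "fill a (Suc 0) = a * fill (a - 1) (Suc 0) + 1"
    by (simp only: fill_Suc[of a 0] fill.simps)
  moreover have "a = (a - c) + c"
    using assms by simp
  ultimately show ?thesis
    by (simp add: walk_term_def flip: distrib_right)
qed

text \<open>The first list of interior vertices starts with one of \<open>a - c\<close> vertices
  without a free partner, or with one of \<open>c\<close> having one, or is empty. In the last case
  the walk enters one of the \<open>c\<close> columns and changes layer there at once; one vertical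
  step is spent and the two layers are exchanged.\<close>

lemma walk_term_Suc_step:
  assumes "c \<le> a"
  shows "walk_term (Suc k) a b c =
    (a - c) * walk_term (Suc k) (a - 1) b c + c * walk_term (Suc k) (a - 1) b (c - 1)
    + c * walk_term k (b - 1) (a - 1) (c - 1)"
proof -
  define s where "s = (k + 1) div 2"
  define g where "g = fill (b - Suc k) (k div 2 + 1)"
  have "falling c (Suc k) * fill (a - Suc k) (Suc s) * g
    = (falling c (Suc k) * (a - Suc k)) * fill (a - 1 - Suc k) (Suc s) * g
      + falling c (Suc k) * fill (a - Suc k) s * g"
    using fill_Suc[of "a - Suc k" s] by (simp add: algebra_simps)
  also have "falling c (Suc k) * (a - Suc k) = (a - c) * falling c (Suc k) + c * falling (c - 1) (Suc k)"
    using falling_step[OF assms] by metis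
  finally show ?thesis
    unfolding walk_term_def by (simp add: s_def g_def algebra_simps del: fill.simps)
qed

lemma walk_count_step:
  assumes "c \<le> a"
  shows "walk_count d a b c = of_bool d + (a - c) * walk_count d (a - 1) b c
    + c * walk_count d (a - 1) b (c - 1) + c * walk_count (\<not> d) (b - 1) (a - 1) (c - 1)"
proof (cases d)
  case True
  \<comment> \<open>The term \<open>k = 0\<close> obeys its own recurrence, which produces the
    summand 1 for the empty interior. The limit is raised to \<open>Suc c\<close> so that the
    shifted sum again runs up to \<open>c\<close>.\<close>
  have "walk_count d a b c = walk_term 0 a b c + (\<Sum>j\<le>c. walk_term (Suc (2 * j + 1)) a b c)"
    using True by (simp add: walk_count_upto[of c "Suc c"] sum.atMost_Suc_shift
        del: sum.atMost_Suc)
  also have "\<dots> = 1 + (a - c) * (walk_term 0 (a - 1) b c + (\<Sum>j\<le>c. walk_term (Suc (2 * j + 1)) (a - 1) b c))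
     + c * (walk_term 0 (a - 1) b (c - 1) + (\<Sum>j\<le>c. walk_term (Suc (2 * j + 1)) (a - 1) b (c - 1)))
     + c * (\<Sum>j\<le>c. walk_term (2 * j + 1) (b - 1) (a - 1) (c - 1))"
    unfolding walk_term_0_step[OF assms, of b] walk_term_Suc_step[OF assms, of _ b]
    by (simp add: sum.distrib sum_distrib_left algebra_simps del: sum.atMost_Suc)
  also have "walk_term 0 (a - 1) b c + (\<Sum>j\<le>c. walk_term (Suc (2 * j + 1)) (a - 1) b c)
    = walk_count d (a - 1) b c"
    using True by (simp add: walk_count_upto[of c "Suc c"] sum.atMost_Suc_shift
        del: sum.atMost_Suc)
  also have "walk_term 0 (a - 1) b (c - 1) + (\<Sum>j\<le>c. walk_term (Suc (2 * j + 1)) (a - 1) b (c - 1))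
    = walk_count d (a - 1) b (c - 1)"
    using True by (simp add: walk_count_upto[of "c - Suc 0" "Suc c"] sum.atMost_Suc_shift
        del: sum.atMost_Suc)
  also have "(\<Sum>j\<le>c. walk_term (2 * j + 1) (b - 1) (a - 1) (c - 1))
    = walk_count (\<not> d) (b - 1) (a - 1) (c - 1)"
    using True by (simp add: walk_count_upto[of "c - Suc 0" c])
  finally show ?thesis using True by simp
next
  case False
  then show ?thesis
    using walk_term_Suc_step[OF assms, of _ b]
    by (simp add: walk_count_upto[of "c - Suc 0" c] walk_count_upto[of c c] sum.distrib
        sum_distrib_left)
qed

subsection \<open>Paths between two layers\<close>

text \<open>Adjacency in the bunkbed graph of a complete graph, up to reflexivity, which is harmless
  because the vertices of a walk are distinct.\<close>

definition adj :: "'a \<times> 'l \<Rightarrow> 'a \<times> 'l \<Rightarrow> bool" where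
  "adj p q \<longleftrightarrow> fst p = fst q \<or> snd p = snd q"

text \<open>The interiors of self-avoiding walks: \<open>P\<close> and \<open>Q\<close> restrict the two end steps, and \<open>e\<close> says
  whether the end points may be joined directly.\<close>

definition paths ::
    "('a \<times> 'l \<Rightarrow> bool) \<Rightarrow> ('a \<times> 'l \<Rightarrow> bool) \<Rightarrow> bool \<Rightarrow> ('a \<times> 'l) set \<Rightarrow> ('a \<times> 'l) list set" where
  "paths P Q e U = {p. distinct p \<and> set p \<subseteq> U \<and> successively adj p \<and>
     (if p = [] then e else P (hd p) \<and> Q (last p))}"

text \<open>Interiors of walks between an outside vertex of layer \<open>i\<close> and one of layer
  \<open>j\<close> whose end steps are horizontal; an empty interior requires
  \<open>i = j\<close>.\<close>

abbreviation layer_paths :: "'l \<Rightarrow> 'l \<Rightarrow> ('a \<times> 'l) set \<Rightarrow> ('a \<times> 'l) list set" where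
  "layer_paths i j \<equiv> paths (\<lambda>q. snd q = i) (\<lambda>q. snd q = j) (i = j)"

definition layer :: "('a \<times> 'l) set \<Rightarrow> 'l \<Rightarrow> 'a set" where
  "layer U i = {x. (x, i) \<in> U}"

lemma adj_commute: "adj p q \<longleftrightarrow> adj q p"
  by (auto simp: adj_def)

lemma finite_paths:
  assumes "finite U"
  shows "finite (paths P Q e U)"
proof (rule finite_subset)
  show "paths P Q e U \<subseteq> {p. set p \<subseteq> U \<and> length p \<le> card U}"
    using card_mono[OF assms] by (auto simp: paths_def distinct_card[symmetric])
qed (rule finite_lists_length_le[OF assms])

lemma card_paths_rev: "card (paths P Q e U) = card (paths Q P e U)"
proof (rule bij_betw_same_card)
  have "rev ` paths P Q e U \<subseteq> paths Q P e U" for P Q :: "'a \<times> 'b \<Rightarrow> bool"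
    by (auto simp: paths_def successively_rev hd_rev last_rev adj_commute)
  then show "bij_betw rev (paths P Q e U) (paths Q P e U)"
    by (intro bij_betw_byWitness[where f' = rev]) auto
qed

text \<open>A vertical first step leads to \<open>(u, i')\<close>. As \<open>(u, i)\<close> is not
  in \<open>U\<close>, the walk must then continue inside layer \<open>i'\<close>, or stop if
  \<open>(u, i')\<close> is a legal last vertex, whence the new flag
  \<open>Q (u, i')\<close>.\<close>

lemma card_paths_start:
  assumes "finite U" "U \<subseteq> UNIV \<times> {i, i'}" "i \<noteq> i'" "(u, i) \<notin> U" "(u, i') \<in> U"
  shows "card (paths (adj (u, i)) Q e U) = card (paths (\<lambda>q. snd q = i) Q e U)
    + card (paths (\<lambda>q. snd q = i') Q (Q (u, i')) (U - {(u, i')}))"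
proof -
  let ?A = "paths (\<lambda>q. snd q = i) Q e U"
  let ?B = "paths (\<lambda>q. snd q = i') Q (Q (u, i')) (U - {(u, i')})"
  have "paths (adj (u, i)) Q e U = ?A \<union> Cons (u, i') ` ?B" (is "?P = _")
  proof (intro equalityI subsetI)
    fix p assume p: "p \<in> ?P"
    show "p \<in> ?A \<union> Cons (u, i') ` ?B"
    proof (cases p)
      case Nil
      then show ?thesis using p by (auto simp: paths_def)
    next
      case (Cons q r)
      obtain x l where q: "q = (x, l)" by force
      show ?thesis
      proof (cases "l = i")
        case True
        then show ?thesis using p Cons q by (auto simp: paths_def)
      next
        case False
        with p Cons q assms have "q = (u, i')" by (auto simp: paths_def adj_def)
        moreover have "r \<in> ?B"
        proof (cases r)
          case Nil
          then show ?thesis using p Cons \<open>q = (u, i')\<close> by (auto simp: paths_def)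
        next
          case (Cons q' r')
          then show ?thesis
            using p \<open>p = q # r\<close> \<open>q = (u, i')\<close> assms
            by (cases q') (auto simp: paths_def adj_def)
        qed
        ultimately show ?thesis using Cons by auto
      qed
    qed
  next
    fix p assume "p \<in> ?A \<union> Cons (u, i') ` ?B"
    then show "p \<in> ?P"
    proof
      assume "p \<in> ?A"
      then show ?thesis by (auto simp: paths_def adj_def)
    next
      assume "p \<in> Cons (u, i') ` ?B"
      then obtain r where "p = (u, i') # r" "r \<in> ?B" by auto
      then show ?thesis
        using assms by (cases r) (auto simp: paths_def adj_def)
    qed
  qed
  moreover have "?A \<inter> Cons (u, i') ` ?B = {}"
    using assms by (auto simp: paths_def)
  moreover have "card (Cons (u, i') ` ?B) = card ?B"
    by (intro card_image) auto
  ultimately show ?thesis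
    using assms by (simp add: card_Un_disjoint finite_paths)
qed

text \<open>After a change of layer at \<open>x\<close> the column \<open>x\<close> is exhausted, so
  the next step is horizontal. Hence both kinds of remainder are again \<open>layer_paths\<close>,
  and the recursion closes.\<close>

lemma layer_paths_unfold:
  assumes "U \<subseteq> UNIV \<times> {i, i'}" "i \<noteq> i'"
  shows "layer_paths i j U = (if i = j then {[]} else {})
    \<union> (\<Union>x\<in>layer U i. Cons (x, i) ` layer_paths i j (U - {(x, i)}))
    \<union> (\<Union>x\<in>layer U i \<inter> layer U i'.
        (\<lambda>p. (x, i) # (x, i') # p) ` layer_paths i' j (U - {(x, i), (x, i')}))"
  (is "?P = ?E \<union> ?H \<union> ?V")
proof (intro equalityI subsetI)
  fix p assume p: "p \<in> ?P"
  show "p \<in> ?E \<union> ?H \<union> ?V"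
  proof (cases p)
    case Nil
    then show ?thesis using p by (auto simp: paths_def)
  next
    case (Cons q r)
    with p obtain x where q: "q = (x, i)" and x: "x \<in> layer U i"
      by (cases q) (auto simp: paths_def layer_def)
    show ?thesis
    proof (cases "r \<noteq> [] \<and> snd (hd r) = i'")
      case False
      have "r \<in> layer_paths i j (U - {(x, i)})"
        using p Cons q False assms
        by (cases r) (auto simp: paths_def)
      then have "p \<in> ?H" unfolding Cons q by (intro UN_I[OF x] imageI)
      then show ?thesis by blast
    next
      case True
      then obtain y s where r: "r = (y, i') # s"
        by (cases r) auto
      have y: "y = x" "x \<in> layer U i'"
        using p Cons q r assms by (auto simp: paths_def adj_def layer_def)
      have "s \<in> layer_paths i' j (U - {(x, i), (x, i')})"
      proof (cases s)
        case Nil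
        then show ?thesis using p Cons q r by (auto simp: paths_def)
      next
        case (Cons t s')
        then show ?thesis
          using p \<open>p = q # r\<close> q r y assms by (cases t) (auto simp: paths_def adj_def)
      qed
      then have "p \<in> ?V" unfolding Cons q r y(1) using x y(2) by blast
      then show ?thesis by blast
    qed
  qed
next
  fix p assume "p \<in> ?E \<union> ?H \<union> ?V"
  then consider "p \<in> ?E" | "p \<in> ?H" | "p \<in> ?V" by blast
  then show "p \<in> ?P"
  proof cases
    case 1
    then show ?thesis by (auto simp: paths_def split: if_splits)
  next
    case 2
    then obtain x r where "x \<in> layer U i" "p = (x, i) # r" "r \<in> layer_paths i j (U - {(x, i)})"
      by auto
    then show ?thesis
      by (cases r) (auto simp: paths_def adj_def layer_def)
  next
    case 3
    then obtain x r where "x \<in> layer U i \<inter> layer U i'" "p = (x, i) # (x, i') # r"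
      "r \<in> layer_paths i' j (U - {(x, i), (x, i')})"
      by auto
    then show ?thesis
      using assms by (cases r) (auto simp: paths_def adj_def layer_def)
  qed
qed

lemma finite_layer: "finite U \<Longrightarrow> finite (layer U i)"
  by (rule finite_subset[of _ "fst ` U"]) (force simp: layer_def)+

lemma layer_Diff_singleton:
  "layer (U - {(x, i)}) i = layer U i - {x}"
  "k \<noteq> i \<Longrightarrow> layer (U - {(x, i)}) k = layer U k"
  by (auto simp: layer_def)

text \<open>By induction on the size of \<open>U\<close>, the decomposition by the first one or two
  vertices yields exactly the recurrence \<open>walk_count_step\<close>.\<close>

lemma card_layer_paths:
  assumes "finite U" "U \<subseteq> UNIV \<times> {i, i'}" "i \<noteq> i'" "j \<in> {i, i'}"
  shows "card (layer_paths i j U) =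
    walk_count (i = j) (card (layer U i)) (card (layer U i')) (card (layer U i \<inter> layer U i'))"
  using assms
proof (induction "card U" arbitrary: U i i' rule: less_induct)
  case less
  let ?A = "layer U i" and ?B = "layer U i'"
  let ?a = "card ?A" and ?b = "card ?B" and ?c = "card (?A \<inter> ?B)" and ?d = "i = j"
  let ?H = "\<lambda>x. Cons (x, i) ` layer_paths i j (U - {(x, i)})"
  let ?V = "\<lambda>x. (\<lambda>p. (x, i) # (x, i') # p) ` layer_paths i' j (U - {(x, i), (x, i')})"
  have fin: "finite ?A" "finite ?B" "finite (?A \<inter> ?B)"
    using less.prems(1) by (auto simp: finite_layer)
  have ca: "?c \<le> ?a"
    using fin by (intro card_mono) auto
  have finH: "finite (?H x)" and finV: "finite (?V x)" for x
    using less.prems(1) by (auto intro!: finite_paths)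
  \<comment> \<open>Deleting \<open>(x, i)\<close> destroys a free column only if its partner
    \<open>(x, i')\<close> is present.\<close>
  have H: "card (?H x) = walk_count ?d (?a - 1) ?b (if x \<in> ?B then ?c - 1 else ?c)"
    if x: "x \<in> ?A" for x
  proof -
    have "card (U - {(x, i)}) < card U"
      using x less.prems(1) by (intro card_Diff1_less) (auto simp: layer_def)
    then have "card (layer_paths i j (U - {(x, i)})) =
        walk_count ?d (card (?A - {x})) ?b (card ((?A - {x}) \<inter> ?B))"
      using less.prems less.hyps[of "U - {(x, i)}" i i']
      by (simp add: layer_Diff_singleton subset_eq)
    moreover have "card (?A - {x}) = ?a - 1"
      using x by simp
    moreover have "(?A - {x}) \<inter> ?B = (?A \<inter> ?B) - {x}" by auto
    then have "card ((?A - {x}) \<inter> ?B) = (if x \<in> ?B then ?c - 1 else ?c)"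
      using x by simp
    ultimately show ?thesis
      by (simp add: card_image)
  qed
  have V: "card (?V x) = walk_count (\<not> ?d) (?b - 1) (?a - 1) (?c - 1)"
    if x: "x \<in> ?A \<inter> ?B" for x
  proof -
    let ?W = "U - {(x, i), (x, i')}"
    have smaller: "card ?W < card U"
      using x less.prems(1) by (intro psubset_card_mono) (auto simp: layer_def)
    have "?W = U - {(x, i)} - {(x, i')}" by auto
    then have layers: "layer ?W i = ?A - {x}" "layer ?W i' = ?B - {x}"
      using less.prems by (auto simp: layer_Diff_singleton)
    have "finite ?W" "?W \<subseteq> UNIV \<times> {i', i}" "i' \<noteq> i" "j \<in> {i', i}"
      using less.prems by auto
    note less.hyps[OF smaller this]
    moreover have "(i' = j) = (\<not> ?d)" using less.prems by auto
    ultimately have "card (layer_paths i' j ?W) =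
        walk_count (\<not> ?d) (card (?B - {x})) (card (?A - {x})) (card ((?B - {x}) \<inter> (?A - {x})))"
      by (simp only: layers)
    moreover have "(?B - {x}) \<inter> (?A - {x}) = (?A \<inter> ?B) - {x}" by auto
    then have "card ((?B - {x}) \<inter> (?A - {x})) = ?c - 1"
      using x by simp
    moreover have "card (?A - {x}) = ?a - 1" "card (?B - {x}) = ?b - 1"
      using x by auto
    ultimately show ?thesis
      by (simp add: card_image inj_on_def)
  qed
  have "card (\<Union>x\<in>?A. ?H x) = (\<Sum>x\<in>?A. card (?H x))"
    using fin finH by (intro card_UN_disjoint) auto
  also have "\<dots> = (\<Sum>x\<in>?A. walk_count ?d (?a - 1) ?b (if x \<in> ?B then ?c - 1 else ?c))"
    using H by (intro sum.cong) auto
  also have "\<dots> = (\<Sum>x\<in>?A - ?B. walk_count ?d (?a - 1) ?b ?c)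
      + (\<Sum>x\<in>?A \<inter> ?B. walk_count ?d (?a - 1) ?b (?c - 1))"
    using fin by (simp add: sum.Int_Diff[of ?A _ ?B])
  also have "\<dots> = (?a - ?c) * walk_count ?d (?a - 1) ?b ?c
      + ?c * walk_count ?d (?a - 1) ?b (?c - 1)"
    using fin by (simp add: card_Diff_subset_Int)
  finally have cH: "card (\<Union>x\<in>?A. ?H x) = \<dots>" .
  have "card (\<Union>x\<in>?A \<inter> ?B. ?V x) = (\<Sum>x\<in>?A \<inter> ?B. card (?V x))"
    using fin finV by (intro card_UN_disjoint) auto
  also have "\<dots> = ?c * walk_count (\<not> ?d) (?b - 1) (?a - 1) (?c - 1)"
    using V by simp
  finally have cV: "card (\<Union>x\<in>?A \<inter> ?B. ?V x) = \<dots>" .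
  have "(\<Union>x\<in>?A. ?H x) \<inter> (\<Union>x\<in>?A \<inter> ?B. ?V x) = {}"
  proof -
    \<comment> \<open>The second vertex lies in layer \<open>i\<close> on one side and in layer
      \<open>i'\<close> on the other.\<close>
    have False if "r \<in> layer_paths i j (U - {(x, i)})" "(x, i) # r = (y, i) # (y, i') # s" for x y r s
      using that less.prems(3) by (auto simp: paths_def)
    then show ?thesis by blast
  qed
  moreover have "(if ?d then {[]} else {}) \<inter> ((\<Union>x\<in>?A. ?H x) \<union> (\<Union>x\<in>?A \<inter> ?B. ?V x)) = {}"
    by auto
  moreover have "card (E \<union> X \<union> Y) = card E + card X + card Y"
    if "finite E" "finite X" "finite Y" "X \<inter> Y = {}" "E \<inter> (X \<union> Y) = {}"
    for E X Y :: "('a \<times> 'b) list set"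
    using that by (simp add: card_Un_disjoint Un_assoc)
  moreover have "finite (\<Union>x\<in>?A. ?H x)" "finite (\<Union>x\<in>?A \<inter> ?B. ?V x)"
    using fin finH finV by blast+
  moreover have "finite (if ?d then {[] :: ('a \<times> 'b) list} else {})"
    by simp
  ultimately have "card (layer_paths i j U) = card (if ?d then {[] :: ('a \<times> 'b) list} else {})
      + card (\<Union>x\<in>?A. ?H x) + card (\<Union>x\<in>?A \<inter> ?B. ?V x)"
    unfolding layer_paths_unfold[OF less.prems(2,3)] by presburger
  also have "\<dots> = walk_count ?d ?a ?b ?c"
    unfolding cH cV walk_count_step[OF ca] by simp
  finally show ?case .
qed

subsection \<open>Estimates\<close>

lemma fill_le_Suc: "fill m s \<le> fill (Suc m) s"
  by (cases s) auto

lemma fill_mono: "m \<le> m' \<Longrightarrow> fill m s \<le> fill m' s"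
  by (rule lift_Suc_mono_le[where f = "\<lambda>m. fill m s"]) (auto simp: fill_le_Suc)

lemma fill_1_Suc: "fill (Suc m) 1 = Suc m * fill m 1 + 1"
  by simp

text \<open>Concatenating the \<open>s + 1\<close> lists gives one arrangement of length
  \<open>t \<le> m\<close>, from which they are recovered by \<open>s\<close> cuts, placed in
  \<open>(t + s) choose s\<close> ways.\<close>

lemma fill_le_choose: "fill m (Suc s) \<le> fill m 1 * ((m + s) choose s)"
proof (induction m "Suc s" arbitrary: s rule: fill.induct)
  case (2 s)
  then show ?case by simp
next
  case (3 m s)
  show ?case
  proof (cases s)
    case 0
    then show ?thesis by simp
  next
    case (Suc t)
    have "fill (Suc m) (Suc s) = Suc m * fill m (Suc s) + fill (Suc m) (Suc t)"
      using Suc by simp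
    also have "\<dots> \<le> Suc m * (fill m 1 * ((m + s) choose s))
        + fill (Suc m) 1 * ((Suc m + t) choose t)"
      by (intro add_mono mult_left_mono 3(1) 3(2)[OF Suc]) auto
    \<comment> \<open>\<open>Suc m * fill m 1\<close> is at most \<open>fill (Suc m) 1\<close>, and
      \<open>Suc m + t = m + s\<close>; Pascal's rule then combines the two binomial
      coefficients.\<close>
    also have "\<dots> \<le> fill (Suc m) 1 * ((m + s) choose s) + fill (Suc m) 1 * ((m + s) choose t)"
      unfolding fill_1_Suc[of m] using Suc by (simp add: algebra_simps)
    also have "\<dots> = fill (Suc m) 1 * ((Suc m + s) choose s)"
      using Suc by (simp add: algebra_simps)
    finally show ?thesis .
  qed
qed

lemma fill_2: "fill m 2 = m * fill m 1 + 1"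
proof (induction m)
  case (Suc m)
  have "fill (Suc m) 2 = Suc m * fill m 2 + fill (Suc m) 1"
    by (simp add: numeral_2_eq_2)
  also have "\<dots> = m * (Suc m * fill m 1 + 1) + 1 + fill (Suc m) 1"
    unfolding Suc.IH by (simp add: algebra_simps)
  also have "\<dots> = Suc m * fill (Suc m) 1 + 1"
    unfolding fill_1_Suc[of m] by (simp add: algebra_simps)
  finally show ?case .
qed simp

text \<open>The left side counts the arrangements of length at least \<open>k\<close>: first their
  initial \<open>k\<close> entries, then the rest.\<close>

lemma falling_mult_fill_le: "falling m k * fill (m - k) 1 \<le> fill m 1"
proof (induction k)
  case (Suc k)
  have "(m - k) * fill (m - Suc k) 1 \<le> fill (m - k) 1"
    using fill_Suc[of "m - k" 0] by simp
  then have "falling m (Suc k) * fill (m - Suc k) 1 \<le> falling m k * fill (m - k) 1"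
    unfolding falling_Suc_right mult.assoc by (rule mult_left_mono) simp
  then show ?case using Suc by linarith
qed simp

lemma falling_add: "falling m (i + j) = falling m i * falling (m - i) j"
  by (induction i arbitrary: m) (auto simp: algebra_simps)

lemma falling_mono: "m \<le> m' \<Longrightarrow> falling m k \<le> falling m' k"
  by (induction k arbitrary: m m') (auto intro!: mult_mono)

lemma choose_mult_fact: "(n choose k) * fact k = falling n k"
proof (induction k arbitrary: n)
  case (Suc k)
  show ?case
  proof (cases n)
    case (Suc n')
    have "(Suc n' choose Suc k) * fact (Suc k) = Suc n' * ((n' choose k) * fact k)"
      using Suc_times_binomial_eq[of n' k] by (simp add: algebra_simps)
    then show ?thesis using Suc Suc.IH by simp
  qed simp
qed simp

text \<open>All counts are compared with \<open>fill m 1\<close>, the number of partial arrangements of an \<open>m\<close>-set.\<close>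

lemma walk_term_even_le:
  "walk_term (2 * Suc i) m (m + 2) m * (fact (Suc i) * fact i) \<le> m * (fill m 1)\<^sup>2"
proof (cases "2 * Suc i \<le> m")
  case True
  let ?k = "2 * Suc i"
  have "walk_term ?k m (m + 2) m * (fact (Suc i) * fact i)
    = falling m ?k * fill (m - ?k) (Suc (Suc i)) * fill (m - 2 * i) (Suc i) * (fact (Suc i) * fact i)"
    using True by (simp add: walk_term_def del: falling.simps fill.simps)
  also have "\<dots> \<le> falling m ?k * (fill (m - ?k) 1 * ((m - ?k + Suc i) choose Suc i))
      * (fill (m - 2 * i) 1 * ((m - 2 * i + i) choose i)) * (fact (Suc i) * fact i)"
    by (intro mult_mono fill_le_choose) auto
  \<comment> \<open>Each factorial turns a binomial coefficient into a falling factorial, and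
    \<open>falling m ?k\<close> is absorbed into one copy of \<open>fill m 1\<close>.\<close>
  also have "\<dots> = (falling m ?k * fill (m - ?k) 1) * fill (m - 2 * i) 1
      * ((((m - ?k + Suc i) choose Suc i) * fact (Suc i)) * (((m - 2 * i + i) choose i) * fact i))"
    by (simp only: mult_ac)
  also have "\<dots> \<le> fill m 1 * fill (m - 2 * i) 1 * (falling (m - Suc i) (Suc i) * falling (m - i) i)"
  proof -
    have "m - ?k + Suc i = m - Suc i" "m - 2 * i + i = m - i" using True by auto
    then show ?thesis
      unfolding choose_mult_fact by (simp only: falling_mult_fill_le mult_right_mono)
  qed
  \<comment> \<open>One of the \<open>i + 1\<close> factors is sacrificed as \<open>m\<close>. The
    other \<open>i\<close>, with the \<open>i\<close> of the second falling factorial, make up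
    \<open>falling m (2 * i)\<close>, which is absorbed into the second
    \<open>fill m 1\<close>.\<close>
  also have "falling (m - Suc i) (Suc i) \<le> m * falling m i"
    by (auto intro!: mult_mono falling_mono)
  then have "fill m 1 * fill (m - 2 * i) 1 * (falling (m - Suc i) (Suc i) * falling (m - i) i)
    \<le> fill m 1 * fill (m - 2 * i) 1 * (m * falling m i * falling (m - i) i)"
    by (intro mult_mono) auto
  also have "\<dots> = m * fill m 1 * (falling m (2 * i) * fill (m - 2 * i) 1)"
    unfolding mult_2 falling_add[of m i i] by (simp only: mult_ac mult_2)
  also have "\<dots> \<le> m * fill m 1 * fill m 1"
    by (intro mult_left_mono falling_mult_fill_le) simp
  finally show ?thesis by (simp add: power2_eq_square)
qed (simp add: walk_term_eq_0)

text \<open>Same scheme as in the even case; here both binomial coefficients have lower index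
  \<open>j\<close>, so no extra factor \<open>m\<close> arises.\<close>

lemma walk_term_odd_le:
  "walk_term (2 * j + 1) m (m + 1) m * (fact j)\<^sup>2 \<le> (fill m 1)\<^sup>2"
proof (cases "2 * j + 1 \<le> m")
  case True
  let ?k = "2 * j + 1"
  have "walk_term ?k m (m + 1) m * (fact j)\<^sup>2
    = falling m ?k * fill (m - ?k) (Suc j) * fill (m - 2 * j) (Suc j) * (fact j * fact j)"
    using True by (simp add: walk_term_def power2_eq_square del: falling.simps fill.simps)
  also have "\<dots> \<le> falling m ?k * (fill (m - ?k) 1 * ((m - ?k + j) choose j))
      * (fill (m - 2 * j) 1 * ((m - 2 * j + j) choose j)) * (fact j * fact j)"
    by (intro mult_mono fill_le_choose) auto
  also have "\<dots> = (falling m ?k * fill (m - ?k) 1) * fill (m - 2 * j) 1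
      * ((((m - ?k + j) choose j) * fact j) * (((m - 2 * j + j) choose j) * fact j))"
    by (simp only: mult_ac)
  also have "\<dots> \<le> fill m 1 * fill (m - 2 * j) 1 * (falling (m - Suc j) j * falling (m - j) j)"
  proof -
    have "m - ?k + j = m - Suc j" "m - 2 * j + j = m - j" using True by auto
    then show ?thesis
      unfolding choose_mult_fact by (simp only: falling_mult_fill_le mult_right_mono)
  qed
  also have "\<dots> \<le> fill m 1 * fill (m - 2 * j) 1 * (falling m j * falling (m - j) j)"
    by (intro mult_mono falling_mono) auto
  also have "\<dots> = fill m 1 * (falling m (2 * j) * fill (m - 2 * j) 1)"
    unfolding mult_2 falling_add[of m j j] by (simp only: mult_ac mult_2)
  also have "\<dots> \<le> fill m 1 * fill m 1"
    by (intro mult_left_mono falling_mult_fill_le) simp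
  finally show ?thesis by (simp add: power2_eq_square)
qed (simp add: walk_term_eq_0)

section \<open>Two series of inverse factorials\<close>

lemma sum_inverse_fact_Suc_fact_le: "(\<Sum>i\<le>N. 1 / (fact (Suc i) * fact i :: real)) \<le> 7 / 4"
proof -
  \<comment> \<open>Subtracting half of the last term makes the bound inductive, since each new term
    is at most a sixth of the previous one. For \<open>N = 0\<close> it is an equality. What matters
    later is \<open>7 / 4 < 2\<close>.\<close>
  have "(\<Sum>i\<le>Suc N. 1 / (fact (Suc i) * fact i :: real))
      \<le> 7 / 4 - 1 / 2 * (1 / (fact (Suc (Suc N)) * fact (Suc N)))" for N
  proof (induction N)
    case (Suc N)
    define y :: real where "y = 1 / (fact (Suc (Suc N)) * fact (Suc N))"
    have y: "y \<ge> 0" by (simp add: y_def)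
    have "1 / (fact (Suc (Suc (Suc N))) * fact (Suc (Suc N)) :: real)
      = y / ((real N + 3) * (real N + 2))"
      by (simp add: y_def field_simps)
    moreover have "y / ((real N + 3) * (real N + 2)) \<le> y / 6"
      using y mult_mono[of 3 "real N + 3" 2 "real N + 2"] by (intro divide_left_mono) auto
    ultimately show ?case
      using Suc.IH y unfolding sum.atMost_Suc[of _ "Suc N"] y_def[symmetric] by linarith
  qed (simp add: fact_numeral)
  from this[of N] show ?thesis
    unfolding sum.atMost_Suc by (smt (verit) divide_nonneg_nonneg fact_ge_zero mult_nonneg_nonneg)
qed

lemma sum_inverse_fact_sq_le: "(\<Sum>i\<le>N. 1 / (fact i :: real)\<^sup>2) \<le> 3"
proof -
  \<comment> \<open>Again strengthened for the induction. The crude value 3 suffices, as it only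
    enters a term of lower order in \<open>m\<close>.\<close>
  have "(\<Sum>i\<le>Suc N. 1 / (fact i :: real)\<^sup>2) \<le> 3 - 1 / (fact (Suc N))\<^sup>2" for N
  proof (induction N)
    case (Suc N)
    define y :: real where "y = 1 / (fact (Suc N))\<^sup>2"
    have y: "y \<ge> 0" by (simp add: y_def)
    have "1 / (fact (Suc (Suc N)) :: real)\<^sup>2 = y / (real N + 2)\<^sup>2"
      by (simp add: y_def field_simps power2_eq_square)
    moreover have "y / (real N + 2)\<^sup>2 \<le> y / 2"
      using y by (intro divide_left_mono) (auto simp: power2_eq_square algebra_simps intro!: add_pos_nonneg)
    ultimately show ?case
      using Suc.IH y unfolding sum.atMost_Suc[of _ "Suc N"] y_def[symmetric] by linarith
  qed simp
  from this[of N] show ?thesis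
    unfolding sum.atMost_Suc by (smt (verit) divide_nonneg_nonneg zero_le_power2)
qed

section \<open>Bounds for the walk counts and their comparison\<close>

lemma walk_count_True_le:
  "real (walk_count True m (m + 2) m) \<le> fill m 1 + 7 / 4 * (m * (fill m 1)\<^sup>2)"
proof -
  let ?M = "real m * (real (fill m 1))\<^sup>2"
  have le: "real (walk_term (2 * Suc i) m (m + 2) m) \<le> ?M * (1 / (fact (Suc i) * fact i))" for i
  proof -
    have "real (walk_term (2 * Suc i) m (m + 2) m * (fact (Suc i) * fact i))
        \<le> real (m * (fill m 1)\<^sup>2)"
      by (intro of_nat_mono walk_term_even_le)
    then show ?thesis
      by (simp add: pos_le_divide_eq del: fact_Suc)
  qed
  \<comment> \<open>The term \<open>j = 0\<close>, without vertical steps, is not covered by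
    \<open>walk_term_even_le\<close> and contributes \<open>fill m 1\<close>.\<close>
  have "walk_count True m (m + 2) m = (\<Sum>j\<le>Suc m. walk_term (2 * j) m (m + 2) m)"
    by (simp add: walk_count_upto[of m "Suc m"] del: sum.atMost_Suc)
  also have "\<dots> = fill m 1 + (\<Sum>j\<le>m. walk_term (2 * Suc j) m (m + 2) m)"
    unfolding sum.atMost_Suc_shift by (simp add: walk_term_def)
  finally have "real (walk_count True m (m + 2) m)
    = fill m 1 + (\<Sum>j\<le>m. real (walk_term (2 * Suc j) m (m + 2) m))"
    by (simp del: fill.simps)
  also have "\<dots> \<le> fill m 1 + (\<Sum>j\<le>m. ?M * (1 / (fact (Suc j) * fact j)))"
    by (intro add_left_mono sum_mono le)
  also have "\<dots> = fill m 1 + ?M * (\<Sum>j\<le>m. 1 / (fact (Suc j) * fact j))"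
    by (simp only: sum_distrib_left)
  also have "\<dots> \<le> fill m 1 + ?M * (7 / 4)"
    by (intro add_left_mono mult_left_mono sum_inverse_fact_Suc_fact_le) simp
  finally show ?thesis by (simp add: mult_ac)
qed

lemma walk_count_False_le: "real (walk_count False m (m + 1) m) \<le> 3 * (fill m 1)\<^sup>2"
proof -
  let ?M = "(real (fill m 1))\<^sup>2"
  have le: "real (walk_term (2 * j + 1) m (m + 1) m) \<le> ?M * (1 / (fact j)\<^sup>2)" for j
  proof -
    have "real (walk_term (2 * j + 1) m (m + 1) m * (fact j)\<^sup>2) \<le> real ((fill m 1)\<^sup>2)"
      by (intro of_nat_mono walk_term_odd_le)
    then show ?thesis
      by (simp add: pos_le_divide_eq)
  qed
  have "real (walk_count False m (m + 1) m) = (\<Sum>j\<le>m. real (walk_term (2 * j + 1) m (m + 1) m))"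
    by (simp add: walk_count_def)
  also have "\<dots> \<le> (\<Sum>j\<le>m. ?M * (1 / (fact j)\<^sup>2))"
    by (intro sum_mono le)
  also have "\<dots> = ?M * (\<Sum>j\<le>m. 1 / (fact j)\<^sup>2)"
    by (simp only: sum_distrib_left)
  also have "\<dots> \<le> ?M * 3"
    by (intro mult_left_mono sum_inverse_fact_sq_le) simp
  finally show ?thesis by simp
qed

text \<open>The two summands come from \<open>k = 1\<close> and \<open>k = 3\<close>. Each is
  asymptotically \<open>m * (fill m 1)\<^sup>2\<close>, so together they exceed the factor
  \<open>7 / 4\<close> of the upper bound.\<close>

lemma walk_count_False_ge:
  assumes "m \<ge> 2"
  shows "m * (fill m 1)\<^sup>2 + m * (m - 1) * (m - 2) * ((m - 2) * fill (m - 2) 1)\<^sup>2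
    \<le> walk_count False (m + 1) (m + 1) m"
proof -
  have falling: "falling m 1 = m" "falling m 3 = m * (m - 1) * (m - 2)"
    by (simp_all add: numeral_eq_Suc)
  have t1: "walk_term 1 (m + 1) (m + 1) m = m * (fill m 1)\<^sup>2"
    unfolding walk_term_def falling by (simp add: power2_eq_square)
  have "m + 1 - 3 = m - 2" "3 div 2 + 1 = (2 :: nat)" "(3 + 1) div 2 = (2 :: nat)"
    by simp_all
  then have t3: "walk_term 3 (m + 1) (m + 1) m = m * (m - 1) * (m - 2) * (fill (m - 2) 2)\<^sup>2"
    unfolding walk_term_def falling power2_eq_square by (simp only: mult_ac)
  have "((m - 2) * fill (m - 2) 1)\<^sup>2 \<le> (fill (m - 2) 2)\<^sup>2"
    unfolding fill_2 by (intro power_mono) auto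
  then have "m * (fill m 1)\<^sup>2 + m * (m - 1) * (m - 2) * ((m - 2) * fill (m - 2) 1)\<^sup>2
    \<le> walk_term 1 (m + 1) (m + 1) m + walk_term 3 (m + 1) (m + 1) m"
    unfolding t1 t3 by (intro add_left_mono mult_left_mono) auto
  also have "\<dots> = (\<Sum>j\<in>{0, 1}. walk_term (2 * j + 1) (m + 1) (m + 1) m)"
    by (simp add: numeral_eq_Suc)
  also have "\<dots> \<le> walk_count False (m + 1) (m + 1) m"
    unfolding walk_count_def using assms by (simp only: if_False) (intro sum_mono2, auto)
  finally show ?thesis .
qed

lemma walk_count_mono: "b \<le> b' \<Longrightarrow> walk_count d a b c \<le> walk_count d a b' c"
  unfolding walk_count_def walk_term_def
  by (intro sum_mono mult_left_mono fill_mono) auto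

text \<open>Two recurrence steps give \<open>m * (m - 1) * fill (m - 2) 1 + m + 1\<close>; the
  surplus \<open>m + 1\<close> fits into \<open>m * fill (m - 2) 1\<close>.\<close>

lemma fill_le_square_mult_fill:
  assumes "m \<ge> 4"
  shows "fill m 1 \<le> m\<^sup>2 * fill (m - 2) 1"
proof -
  obtain k where k: "m = Suc (Suc k)" "k \<ge> 2"
    using assms by (intro that[of "m - 2"]) auto
  have "2 * 1 + 1 \<le> fill 2 1" by (simp add: numeral_eq_Suc)
  also have "\<dots> \<le> fill k 1" using k by (intro fill_mono)
  finally have "2 \<le> fill k 1" by simp
  then have "m * 2 \<le> m * fill k 1" by (rule mult_left_mono) simp
  moreover have "fill m 1 = m * (m - 1) * fill k 1 + m + 1"
    unfolding k(1) fill_1_Suc by (simp add: algebra_simps)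
  moreover have "m\<^sup>2 * fill k 1 = m * (m - 1) * fill k 1 + m * fill k 1"
    using k by (simp add: power2_eq_square algebra_simps)
  ultimately show ?thesis using k by simp
qed

text \<open>The difference has leading part \<open>m ^ 4 * (m / 4 - 14)\<close>, nonnegative from 56
  on; this is where the threshold 60 comes from.\<close>

lemma quintic_gt:
  assumes "m \<ge> (60 :: real)"
  shows "(3 / 4 * m + 7) * m ^ 4 < m * (m - 1) * (m - 2) * (m - 2)\<^sup>2"
proof -
  have "m * (m - 1) * (m - 2) * (m - 2)\<^sup>2 - (3 / 4 * m + 7) * m ^ 4
    = m ^ 4 * (m / 4 - 14) + m\<^sup>2 * (18 * m - 20) + 8 * m"
    by (simp add: power2_eq_square power4_eq_xxxx field_simps)
  also have "\<dots> > 0"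
    using assms by (intro add_nonneg_pos add_nonneg_nonneg mult_nonneg_nonneg) auto
  finally show ?thesis by simp
qed

lemma walk_count_less:
  assumes "m \<ge> 60"
  shows "walk_count True m (m + 2) m + 2 * walk_count False m (m + 1) m + walk_count True m m m
    < walk_count False (m + 1) (m + 1) m + 2 * walk_count True m (m + 1) m + walk_count False m m m"
proof -
  define x where "x = real m"
  define H where "H = real (fill m 1)"
  define h where "h = real (fill (m - 2) 1)"
  have "1 \<le> fill (m - 2) 1" "1 \<le> fill m 1"
    using fill_mono[of 0 _ 1] by fastforce+
  then have h: "h \<ge> 1" and H: "H \<ge> 1" by (simp_all add: h_def H_def)
  have x: "x \<ge> 60" using assms by (simp add: x_def)
  have "real (fill m 1) \<le> real (m\<^sup>2 * fill (m - 2) 1)"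
    using assms by (intro of_nat_mono fill_le_square_mult_fill) simp
  then have Hh: "H \<le> x\<^sup>2 * h" by (simp add: H_def h_def x_def)
  have "H * 1 \<le> H * H" using H by (intro mult_left_mono) auto
  then have "H \<le> H\<^sup>2" by (simp add: power2_eq_square)
  moreover have "real (walk_count True m (m + 2) m) \<le> H + 7 / 4 * (x * H\<^sup>2)"
    using walk_count_True_le[of m] by (simp only: H_def x_def of_nat_mult of_nat_power)
  moreover have "real (walk_count False m (m + 1) m) \<le> 3 * H\<^sup>2"
    using walk_count_False_le[of m] by (simp only: H_def of_nat_mult of_nat_power of_nat_numeral)
  ultimately have "real (walk_count True m (m + 2) m + 2 * walk_count False m (m + 1) m)
      \<le> (7 / 4 * x + 7) * H\<^sup>2"
    by (simp add: algebra_simps)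
  \<comment> \<open>The part \<open>x * H\<^sup>2\<close> is matched by the term
    \<open>k = 1\<close>, and the remainder is compared with the term \<open>k = 3\<close> through
    \<open>H \<le> x\<^sup>2 * h\<close>.\<close>
  also have "\<dots> = x * H\<^sup>2 + (3 / 4 * x + 7) * H\<^sup>2" by (simp add: algebra_simps)
  also have "(3 / 4 * x + 7) * H\<^sup>2 \<le> (3 / 4 * x + 7) * (x\<^sup>2 * h)\<^sup>2"
    using H Hh x by (intro mult_left_mono power_mono) auto
  also have "\<dots> = (3 / 4 * x + 7) * x ^ 4 * h\<^sup>2"
    by (simp add: power_mult_distrib flip: power_mult)
  also have "\<dots> < x * (x - 1) * (x - 2) * (x - 2)\<^sup>2 * h\<^sup>2"
    using quintic_gt[OF x] h by (intro mult_strict_right_mono) auto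
  also have "x * H\<^sup>2 + x * (x - 1) * (x - 2) * (x - 2)\<^sup>2 * h\<^sup>2
    = real (m * (fill m 1)\<^sup>2 + m * (m - 1) * (m - 2) * ((m - 2) * fill (m - 2) 1)\<^sup>2)"
    using assms by (simp add: x_def H_def h_def of_nat_diff power_mult_distrib)
  also have "\<dots> \<le> real (walk_count False (m + 1) (m + 1) m)"
    using assms by (intro of_nat_mono walk_count_False_ge) simp
  finally have "walk_count True m (m + 2) m + 2 * walk_count False m (m + 1) m
      < walk_count False (m + 1) (m + 1) m"
    by simp
  moreover have "walk_count True m m m \<le> walk_count True m (m + 1) m"
    by (rule walk_count_mono) simp
  ultimately show ?thesis by simp
qed

subsection \<open>Self-avoiding walks on the bunkbed graph of a complete graph\<close>

lemma edge_bunkbed_complete_graph: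
  assumes "p \<in> {..<n} \<times> {0, 1}" "q \<in> {..<n} \<times> {0, 1}" "p \<noteq> q"
  shows "{p, q} \<in> edges (bunkbed (complete_graph n)) \<longleftrightarrow> adj p q"
proof -
  obtain x i y j where pq: "p = (x, i)" "q = (y, j)" by (cases p, cases q)
  have E: "{a, b} \<in> edges (complete_graph n) \<longleftrightarrow> a < n \<and> b < n \<and> a \<noteq> b" for a b
    by (auto simp: complete_graph_def doubleton_eq_iff)
  show ?thesis
    using assms unfolding pq bunkbed_def adj_def
    by (auto simp: E doubleton_eq_iff) (auto simp: complete_graph_def)
qed

text \<open>The graph is simple, so the vertex list determines the edge list and only vertex lists
  need to be counted.\<close>

lemma saws_bunkbed_complete_graph_iff:
  "(ws, es) \<in> saws (bunkbed (complete_graph n)) x y \<longleftrightarrow>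
    ws \<noteq> [] \<and> hd ws = x \<and> last ws = y \<and> distinct ws \<and> set ws \<subseteq> {..<n} \<times> {0, 1} \<and>
    successively adj ws \<and> es = map (\<lambda>i. {ws ! i, ws ! Suc i}) [0..<length ws - 1]"
proof -
  have V: "vertices (bunkbed (complete_graph n)) = {..<n} \<times> {0, 1}"
    by (simp add: bunkbed_def complete_graph_def)
  have edge: "{ws ! i, ws ! Suc i} \<in> edges (bunkbed (complete_graph n)) \<longleftrightarrow> adj (ws ! i) (ws ! Suc i)"
    if "distinct ws" "set ws \<subseteq> {..<n} \<times> {0, 1}" "Suc i < length ws" for i
  proof (rule edge_bunkbed_complete_graph)
    show "ws ! i \<in> {..<n} \<times> {0, 1}" "ws ! Suc i \<in> {..<n} \<times> {0, 1}"
      using that by (meson Suc_lessD nth_mem subset_iff)+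
    show "ws ! i \<noteq> ws ! Suc i"
      using that by (simp add: nth_eq_iff_index_eq)
  qed
  have len: "length ws = Suc (length es) \<longleftrightarrow> ws \<noteq> [] \<and> length es = length ws - 1"
    by (cases ws) auto
  have es: "es = map (\<lambda>i. {ws ! i, ws ! Suc i}) [0..<length ws - 1] \<longleftrightarrow>
    length es = length ws - 1 \<and> (\<forall>i<length es. es ! i = {ws ! i, ws ! Suc i})"
    by (auto simp: list_eq_iff_nth_eq)
  have steps: "(\<forall>i<length es. es ! i \<in> edges (bunkbed (complete_graph n)) \<and> es ! i = {ws ! i, ws ! Suc i})
      \<longleftrightarrow> successively adj ws \<and> (\<forall>i<length es. es ! i = {ws ! i, ws ! Suc i})"
    if "distinct ws" "set ws \<subseteq> {..<n} \<times> {0, 1}" "length ws = Suc (length es)"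
    using edge[OF that(1,2)] that(3) by (auto simp: successively_conv_nth)
  show ?thesis
  proof (cases "distinct ws \<and> set ws \<subseteq> {..<n} \<times> {0, 1} \<and> length ws = Suc (length es)")
    case True
    then show ?thesis
      unfolding saws_def V es mem_Collect_eq prod.case using steps len by blast
  next
    case False
    then show ?thesis
      unfolding saws_def V es mem_Collect_eq prod.case using len by blast
  qed
qed

lemma card_saws_eq_paths:
  assumes "x \<noteq> y" "x \<in> {..<n} \<times> {0, 1}" "y \<in> {..<n} \<times> {0, 1}"
  shows "card (saws (bunkbed (complete_graph n)) x y) =
    card (paths (adj x) (adj y) (adj x y) ({..<n} \<times> {0, 1} - {x, y}))"
proof -
  let ?S = "saws (bunkbed (complete_graph n)) x y"
  let ?P = "paths (adj x) (adj y) (adj x y) ({..<n} \<times> {0, 1} - {x, y})"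
  let ?g = "\<lambda>p. let ws = x # p @ [y] in (ws, map (\<lambda>i. {ws ! i, ws ! Suc i}) [0..<length ws - 1])"
  have P: "p \<in> ?P \<longleftrightarrow> distinct (x # p @ [y]) \<and> set (x # p @ [y]) \<subseteq> {..<n} \<times> {0, 1}
      \<and> successively adj (x # p @ [y])" for p
    using assms
    by (auto simp: paths_def successively_Cons successively_append_iff adj_commute)
  have "?S \<subseteq> ?g ` ?P"
  proof (rule subrelI)
    fix ws es assume w: "(ws, es) \<in> ?S"
    then have "ws = x # butlast (tl ws) @ [y]"
      unfolding saws_bunkbed_complete_graph_iff using assms(1)
      by (cases ws) (auto split: if_splits)
    then obtain p where p: "ws = x # p @ [y]" by blast
    have "p \<in> ?P"
      using w unfolding saws_bunkbed_complete_graph_iff P p by blast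
    moreover have "(ws, es) = ?g p"
      using w unfolding saws_bunkbed_complete_graph_iff p Let_def by blast
    ultimately show "(ws, es) \<in> ?g ` ?P" by blast
  qed
  moreover have "?g ` ?P \<subseteq> ?S"
  proof (rule image_subsetI)
    fix p assume "p \<in> ?P"
    then show "?g p \<in> ?S"
      unfolding P Let_def saws_bunkbed_complete_graph_iff by simp
  qed
  ultimately have "?S = ?g ` ?P"
    by (rule subset_antisym)
  then show ?thesis
    by (simp only:) (rule card_image, auto simp: inj_on_def Let_def)
qed

text \<open>The summands correspond to the end steps being horizontal or vertical:
  \<open>card_paths_start\<close> is applied at \<open>u\<close> and, after reversal, at
  \<open>v\<close>. A vertical end step uses up the partner of that end point.\<close>

lemma card_paths_between_vertices:
  assumes "finite U" "U \<subseteq> UNIV \<times> {i, i'}" "i \<noteq> i'" "j \<noteq> j'" "{i, i'} = {j, j'}" "u \<noteq> v"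
    "(u, i) \<notin> U" "(u, i') \<in> U" "(v, j) \<notin> U" "(v, j') \<in> U"
  shows "card (paths (adj (u, i)) (adj (v, j)) (i = j) U) =
    card (layer_paths j i U) + card (layer_paths j' i (U - {(v, j')}))
    + card (layer_paths j i' (U - {(u, i')})) + card (layer_paths j' i' (U - {(u, i'), (v, j')}))"
proof -
  have "card (paths (adj (u, i)) (adj (v, j)) (i = j) U) =
      card (paths (adj (v, j)) (\<lambda>q. snd q = i) (i = j) U)
      + card (paths (adj (v, j)) (\<lambda>q. snd q = i') (i' = j) (U - {(u, i')}))"
    using assms by (simp add: card_paths_start[of U i i'] card_paths_rev[of "\<lambda>q. snd q = _"] adj_def
        eq_commute[of j i'])
  also have "card (paths (adj (v, j)) (\<lambda>q. snd q = i) (i = j) U)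
      = card (layer_paths j i U) + card (layer_paths j' i (U - {(v, j')}))"
    using assms by (simp add: card_paths_start[of U j j'] eq_commute)
  also have "card (paths (adj (v, j)) (\<lambda>q. snd q = i') (i' = j) (U - {(u, i')}))
      = card (layer_paths j i' (U - {(u, i')}))
        + card (layer_paths j' i' (U - {(u, i')} - {(v, j')}))"
    using assms by (subst card_paths_start[of _ j j']) (auto simp: eq_commute[of i' j])
  also have "U - {(u, i')} - {(v, j')} = U - {(u, i'), (v, j')}" by auto
  finally show ?thesis by simp
qed

lemma layer_Diff: "layer (U - W) i = layer U i - layer W i"
  and layer_Times: "layer (A \<times> I) i = (if i \<in> I then A else {})"
  and layer_insert: "layer (insert (x, k) W) i = (if k = i then insert x (layer W i) else layer W i)"
  and layer_empty: "layer {} i = {}"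
  by (auto simp: layer_def)

lemmas layer_simps = layer_Diff layer_Times layer_insert layer_empty

lemma card_layer_paths_01:
  fixes i j n :: nat
  assumes "W \<subseteq> {..<n} \<times> {0, 1}" "i \<in> {0, 1}" "j \<in> {0, 1}"
  shows "card (layer_paths i j W) = walk_count (i = j) (card (layer W i)) (card (layer W (1 - i)))
    (card (layer W i \<inter> layer W (1 - i)))"
proof (rule card_layer_paths)
  show "finite W" using assms(1) by (rule finite_subset) simp
qed (use assms in auto)

text \<open>With \<open>2 * j + 1\<close> vertical steps there are \<open>j + 1\<close> segments in
  either layer.\<close>

lemma walk_count_False_commute: "walk_count False a b c = walk_count False b a c"
  by (simp add: walk_count_def walk_term_def mult_ac)

text \<open>In all cases the columns of \<open>u\<close> and \<open>v\<close> have lost at least one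
  end, so exactly \<open>m\<close> free columns remain; only the layer sizes vary.\<close>

lemma
  assumes "u < m + 2" "v < m + 2" "u \<noteq> v"
  shows card_saws_same_layer: "card (saws (bunkbed (complete_graph (m + 2))) (u, 0) (v, 0)) =
      walk_count True m (m + 2) m + 2 * walk_count False m (m + 1) m + walk_count True m m m"
    and card_saws_opposite_layer: "card (saws (bunkbed (complete_graph (m + 2))) (u, 0) (v, 1)) =
      walk_count False (m + 1) (m + 1) m + 2 * walk_count True m (m + 1) m + walk_count False m m m"
proof -
  define S where "S = {..<m + 2}"
  have S: "u \<in> S" "v \<in> S" "finite S" "S \<subseteq> {..<m + 2}"
    using assms by (auto simp: S_def)
  have cards: "card (S - {u}) = m + 1" "card (S - {v}) = m + 1" "card (S - {u, v}) = m"
    "card (S - {v, u}) = m" "card S = m + 2"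
    using assms by (simp_all add: S_def card_Diff_subset)
  have ints: "(S - A) \<inter> S = S - A" "S \<inter> (S - A) = S - A" "(S - A) \<inter> (S - B) = S - (A \<union> B)"
    "S - A - B = S - (A \<union> B)" "{u, v, u} = {u, v}" for A B
    by auto
  let ?U = "S \<times> {0, 1 :: nat} - {(u, 0), (v, 0)}"
  have "card (saws (bunkbed (complete_graph (m + 2))) (u, 0) (v, 0))
      = card (paths (adj (u, 0)) (adj (v, 0)) (0 = (0 :: nat)) ?U)"
    unfolding S_def using assms by (subst card_saws_eq_paths) (auto simp: adj_def)
  also have "\<dots> = card (layer_paths 0 0 ?U)
      + card (layer_paths 1 0 (?U - {(v, 1)}))
      + card (layer_paths 0 1 (?U - {(u, 1)}))
      + card (layer_paths 1 1 (?U - {(u, 1), (v, 1)}))"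
    using S assms by (intro card_paths_between_vertices) auto
  also have "card (layer_paths 0 0 ?U) = walk_count True m (m + 2) m"
    using S assms cards by (subst card_layer_paths_01[of _ "m + 2"]) (auto simp: layer_simps ints)
  also have "card (layer_paths 1 0 (?U - {(v, 1)})) = walk_count False (m + 1) m m"
    using S assms cards by (subst card_layer_paths_01[of _ "m + 2"]) (auto simp: layer_simps ints)
  also have "card (layer_paths 0 1 (?U - {(u, 1)})) = walk_count False m (m + 1) m"
    using S assms cards by (subst card_layer_paths_01[of _ "m + 2"]) (auto simp: layer_simps ints)
  also have "card (layer_paths 1 1 (?U - {(u, 1), (v, 1)})) = walk_count True m m m"
    using S assms cards by (subst card_layer_paths_01[of _ "m + 2"]) (auto simp: layer_simps ints)
  finally show "card (saws (bunkbed (complete_graph (m + 2))) (u, 0) (v, 0)) =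
      walk_count True m (m + 2) m + 2 * walk_count False m (m + 1) m + walk_count True m m m"
    by (simp add: walk_count_False_commute[of "Suc m"])

  let ?W = "S \<times> {0, 1 :: nat} - {(u, 0), (v, 1)}"
  have "card (saws (bunkbed (complete_graph (m + 2))) (u, 0) (v, 1))
      = card (paths (adj (u, 0)) (adj (v, 1)) (0 = (1 :: nat)) ?W)"
    unfolding S_def using assms by (subst card_saws_eq_paths) (auto simp: adj_def)
  also have "\<dots> = card (layer_paths 1 0 ?W)
      + card (layer_paths 0 0 (?W - {(v, 0)}))
      + card (layer_paths 1 1 (?W - {(u, 1)}))
      + card (layer_paths 0 1 (?W - {(u, 1), (v, 0)}))"
    using S assms by (intro card_paths_between_vertices) auto
  also have "card (layer_paths 1 0 ?W) = walk_count False (m + 1) (m + 1) m"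
    using S assms cards by (subst card_layer_paths_01[of _ "m + 2"]) (auto simp: layer_simps ints)
  also have "card (layer_paths 0 0 (?W - {(v, 0)})) = walk_count True m (m + 1) m"
    using S assms cards by (subst card_layer_paths_01[of _ "m + 2"]) (auto simp: layer_simps ints)
  also have "card (layer_paths 1 1 (?W - {(u, 1)})) = walk_count True m (m + 1) m"
    using S assms cards by (subst card_layer_paths_01[of _ "m + 2"]) (auto simp: layer_simps ints)
  also have "card (layer_paths 0 1 (?W - {(u, 1), (v, 0)})) = walk_count False m m m"
    using S assms cards by (subst card_layer_paths_01[of _ "m + 2"]) (auto simp: layer_simps ints)
  finally show "card (saws (bunkbed (complete_graph (m + 2))) (u, 0) (v, 1)) =
      walk_count False (m + 1) (m + 1) m + 2 * walk_count True m (m + 1) m + walk_count False m m m"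
    by simp
qed

theorem theorem1p7:
  "(\<forall>u\<in>vertices (complete_graph 2). \<forall>v\<in>vertices (complete_graph 2). u \<noteq> v \<longrightarrow>
      card (saws (bunkbed (complete_graph 2)) (u, 0) (v, 0))
      = card (saws (bunkbed (complete_graph 2)) (u, 0) (v, 1))) \<and>
   (\<forall>n\<in>{3, 4, 5}.
      \<forall>u\<in>vertices (complete_graph n). \<forall>v\<in>vertices (complete_graph n). u \<noteq> v \<longrightarrow>
        card (saws (bunkbed (complete_graph n)) (u, 0) (v, 0))
        < card (saws (bunkbed (complete_graph n)) (u, 0) (v, 1))) \<and>
   (\<exists>N\<ge>2. \<forall>n\<ge>N.
      \<forall>u\<in>vertices (complete_graph n). \<forall>v\<in>vertices (complete_graph n). u \<noteq> v \<longrightarrow>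
        card (saws (bunkbed (complete_graph n)) (u, 0) (v, 0))
        < card (saws (bunkbed (complete_graph n)) (u, 0) (v, 1)))"
proof -
  let ?F = "\<lambda>m. walk_count True m (m + 2) m + 2 * walk_count False m (m + 1) m + walk_count True m m m"
  let ?G = "\<lambda>m. walk_count False (m + 1) (m + 1) m + 2 * walk_count True m (m + 1) m
    + walk_count False m m m"
  have F: "card (saws (bunkbed (complete_graph n)) (u, 0) (v, 0)) = ?F m"
    and G: "card (saws (bunkbed (complete_graph n)) (u, 0) (v, 1)) = ?G m"
    if "n = m + 2" "u \<in> vertices (complete_graph n)" "v \<in> vertices (complete_graph n)" "u \<noteq> v"
    for n m u v
  proof -
    have "u < m + 2" "v < m + 2"
      using that by (simp_all add: complete_graph_def)
    then show "card (saws (bunkbed (complete_graph n)) (u, 0) (v, 0)) = ?F m"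
      "card (saws (bunkbed (complete_graph n)) (u, 0) (v, 1)) = ?G m"
      unfolding \<open>n = m + 2\<close>
      using card_saws_same_layer card_saws_opposite_layer \<open>u \<noteq> v\<close> by blast+
  qed
  have less: "\<forall>u\<in>vertices (complete_graph n). \<forall>v\<in>vertices (complete_graph n). u \<noteq> v \<longrightarrow>
      card (saws (bunkbed (complete_graph n)) (u, 0) (v, 0))
      < card (saws (bunkbed (complete_graph n)) (u, 0) (v, 1))"
    if "n = m + 2" "?F m < ?G m" for n m
    using F[OF that(1)] G[OF that(1)] that(2) by simp
  \<comment> \<open>Evaluation at \<open>m = n - 2\<close> for \<open>n\<close> from 2 to 5.\<close>
  have small: "?F 0 = ?G 0" "?F 1 < ?G 1" "?F 2 < ?G 2" "?F 3 < ?G 3"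
    by code_simp+
  show ?thesis
  proof (intro conjI)
    show "\<forall>u\<in>vertices (complete_graph 2). \<forall>v\<in>vertices (complete_graph 2). u \<noteq> v \<longrightarrow>
      card (saws (bunkbed (complete_graph 2)) (u, 0) (v, 0))
      = card (saws (bunkbed (complete_graph 2)) (u, 0) (v, 1))"
      using F[of 2 0] G[of 2 0] small(1) by simp
  next
    show "\<forall>n\<in>{3, 4, 5}.
      \<forall>u\<in>vertices (complete_graph n). \<forall>v\<in>vertices (complete_graph n). u \<noteq> v \<longrightarrow>
        card (saws (bunkbed (complete_graph n)) (u, 0) (v, 0))
        < card (saws (bunkbed (complete_graph n)) (u, 0) (v, 1))"
      using less[of 3 1] less[of 4 2] less[of 5 3] small(2-) by simp
  next
    have "\<forall>u\<in>vertices (complete_graph n). \<forall>v\<in>vertices (complete_graph n). u \<noteq> v \<longrightarrow>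
        card (saws (bunkbed (complete_graph n)) (u, 0) (v, 0))
        < card (saws (bunkbed (complete_graph n)) (u, 0) (v, 1))" if "n \<ge> 62" for n
      \<comment> \<open>The bound 62 is the threshold 60 for \<open>m\<close>, shifted by the two
        end points.\<close>
      using that by (intro less[of n "n - 2"] walk_count_less) auto
    then show "\<exists>N\<ge>2. \<forall>n\<ge>N.
      \<forall>u\<in>vertices (complete_graph n). \<forall>v\<in>vertices (complete_graph n). u \<noteq> v \<longrightarrow>
        card (saws (bunkbed (complete_graph n)) (u, 0) (v, 0))
        < card (saws (bunkbed (complete_graph n)) (u, 0) (v, 1))"
      by (intro exI[of _ 62]) auto
  qed
qed

end
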